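(* Let $(\mathscr{D},\Phi,g,A,\nabla^0)$ be the geometrization of an elliptic Monge--Ampère equation, where $\mathscr{D}$ is a strictly convex bounded domain and $\Phi$ is a smooth convex function with smooth boundary values. Assume that it contains a non-empty flat locus $\mathscr{N}$. Then $\mathscr{N}$ is a Frobenius locus and the WDVV equation is satisfied on $\mathscr{N}$.
   Context: Geometrization of an elliptic Monge--Ampère equation: $\mathscr{D}\subset\mathbb{R}^n$ is a strictly convex domain, $\Phi$ is a real convex smooth function with $\det\mathrm{Hess}(\Phi)=f$, $f>0$; $\nabla^0$ is the flat torsionless affine connection of the affine coordinates $(x^1,\dots,x^n)$, $g_{ij}=\partial_i\partial_j\Phi$ is the Hessian metric and $A_{ijk}=\partial_i\partial_j\partial_k\Phi$. A flat locus is a locus $\mathscr{N}\subset\mathscr{D}$ on which the Riemann curvature tensor of $g$ vanishes. The Associativity (WDVV) Equation is: for all $a,b,c,d$, $$\sum_{e,f}\partial_a\partial_b\partial_e\Phi\; g^{ef}\;\partial_f\partial_c\partial_d\Phi=\sum_{e,f}\partial_b\partial_c\partial_e\Phi\; g^{ef}\;\partial_f\partial_a\partial_d\Phi,$$ where $[g^{ef}]=[g_{ef}]^{-1}$. A Frobenius locus of $(\mathscr{D},\Phi,g,A,\nabla^0)$ is a locus on which the Associativity Equations are satisfied. *)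

theory Defs
  imports "HOL-Analysis.Analysis"
begin

definition pderiv_at :: "'n::finite \<Rightarrow> (real^'n \<Rightarrow> real) \<Rightarrow> real^'n \<Rightarrow> real" where
  "pderiv_at i F x = frechet_derivative F (at x) (axis i 1)"

text \<open>The following notions of regularity are meant for open sets only.\<close>

fun Ck_on :: "nat \<Rightarrow> (real^'n::finite \<Rightarrow> real) \<Rightarrow> (real^'n) set \<Rightarrow> bool" where
  "Ck_on 0 F U \<longleftrightarrow> continuous_on U F"
| "Ck_on (Suc k) F U \<longleftrightarrow> F differentiable_on U \<and> (\<forall>i. Ck_on k (pderiv_at i F) U)"

definition smooth_on :: "(real^'n::finite \<Rightarrow> real) \<Rightarrow> (real^'n) set \<Rightarrow> bool" where
  "smooth_on F U \<longleftrightarrow> (\<forall>k. Ck_on k F U)"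

definition strictly_convex_domain :: "(real^'n::finite) set \<Rightarrow> bool" where
  "strictly_convex_domain D \<longleftrightarrow> open D \<and> D \<noteq> {} \<and> convex D \<and>
     (\<forall>x\<in>closure D. \<forall>y\<in>closure D. x \<noteq> y \<longrightarrow> open_segment x y \<subseteq> D)"

text \<open>The boundary values are the limits of the function from inside the domain; they are smooth
  if they are the restriction of a function that is smooth near the boundary.\<close>

definition smooth_boundary_values :: "(real^'n::finite) set \<Rightarrow> (real^'n \<Rightarrow> real) \<Rightarrow> bool" where
  "smooth_boundary_values D F \<longleftrightarrow>
     (\<exists>U \<phi>. open U \<and> frontier D \<subseteq> U \<and> smooth_on \<phi> U \<and>
        (\<forall>b\<in>frontier D. (F \<longlongrightarrow> \<phi> b) (at b within D)))"

definition hessian :: "(real^'n::finite \<Rightarrow> real) \<Rightarrow> real^'n \<Rightarrow> real^'n^'n" where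
  "hessian F x = (\<chi> i j. pderiv_at i (pderiv_at j F) x)"

text \<open>A metric is given by its matrix field \<open>g x $ i $ j\<close> in the affine coordinates, and an affine
  connection by its coefficients: \<open>\<Gamma> x k i j\<close> is the \<open>k\<close>-th component of the covariant derivative
  of the \<open>j\<close>-th coordinate field along the \<open>i\<close>-th one.\<close>

type_synonym 'n metric = "real^'n \<Rightarrow> real^'n^'n"
type_synonym 'n connection = "real^'n \<Rightarrow> 'n \<Rightarrow> 'n \<Rightarrow> 'n \<Rightarrow> real"

definition levi_civita :: "('n::finite) metric \<Rightarrow> 'n connection" where
  "levi_civita g x k i j =
     (\<Sum>l\<in>UNIV. matrix_inv (g x) $ k $ l *
        (pderiv_at i (\<lambda>y. g y $ j $ l) x + pderiv_at j (\<lambda>y. g y $ i $ l) x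
          - pderiv_at l (\<lambda>y. g y $ i $ j) x)) / 2"

text \<open>\<open>curvature \<Gamma> x l k i j\<close> is the \<open>l\<close>-th component of \<open>R(\<partial>\<^sub>i, \<partial>\<^sub>j) \<partial>\<^sub>k\<close>.\<close>

definition curvature :: "('n::finite) connection \<Rightarrow> real^'n \<Rightarrow> 'n \<Rightarrow> 'n \<Rightarrow> 'n \<Rightarrow> 'n \<Rightarrow> real" where
  "curvature \<Gamma> x l k i j =
     pderiv_at i (\<lambda>y. \<Gamma> y l j k) x - pderiv_at j (\<lambda>y. \<Gamma> y l i k) x
       + (\<Sum>m\<in>UNIV. \<Gamma> x l i m * \<Gamma> x m j k - \<Gamma> x l j m * \<Gamma> x m i k)"

definition riemann_curvature ::
  "('n::finite) metric \<Rightarrow> real^'n \<Rightarrow> 'n \<Rightarrow> 'n \<Rightarrow> 'n \<Rightarrow> 'n \<Rightarrow> real" where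
  "riemann_curvature g = curvature (levi_civita g)"

text \<open>The connection \<open>nabla0\<close> is determined by the coordinate fields being parallel; this makes it flat
  and torsionless.\<close>

definition monge_ampere_geometrization ::
  "(real^'n::finite \<Rightarrow> real) \<Rightarrow> (real^'n) set \<Rightarrow> (real^'n \<Rightarrow> real) \<Rightarrow> 'n metric \<Rightarrow>
     (real^'n \<Rightarrow> 'n \<Rightarrow> 'n \<Rightarrow> 'n \<Rightarrow> real) \<Rightarrow> 'n connection \<Rightarrow> bool" where
  "monge_ampere_geometrization f D \<Phi> g A nabla0 \<longleftrightarrow>
     strictly_convex_domain D \<and> smooth_on \<Phi> D \<and> convex_on D \<Phi> \<and>
     (\<forall>x\<in>D. f x > 0 \<and> det (hessian \<Phi> x) = f x) \<and>
     (\<forall>x\<in>D. g x = hessian \<Phi> x) \<and>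
     (\<forall>x\<in>D. \<forall>i j k. A x i j k = pderiv_at i (pderiv_at j (pderiv_at k \<Phi>)) x) \<and>
     (\<forall>x\<in>D. \<forall>k i j. nabla0 x k i j = 0)"

definition flat_locus :: "(real^'n::finite) set \<Rightarrow> 'n metric \<Rightarrow> (real^'n) set \<Rightarrow> bool" where
  "flat_locus D g N \<longleftrightarrow> N \<subseteq> D \<and> (\<forall>x\<in>N. \<forall>l k i j. riemann_curvature g x l k i j = 0)"

definition wdvv_at :: "(real^'n::finite \<Rightarrow> real) \<Rightarrow> 'n metric \<Rightarrow> real^'n \<Rightarrow> bool" where
  "wdvv_at \<Phi> g x \<longleftrightarrow>
     (\<forall>a b c d.
        (\<Sum>e\<in>UNIV. \<Sum>f\<in>UNIV. pderiv_at a (pderiv_at b (pderiv_at e \<Phi>)) x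
            * matrix_inv (g x) $ e $ f * pderiv_at f (pderiv_at c (pderiv_at d \<Phi>)) x)
      = (\<Sum>e\<in>UNIV. \<Sum>f\<in>UNIV. pderiv_at b (pderiv_at c (pderiv_at e \<Phi>)) x
            * matrix_inv (g x) $ e $ f * pderiv_at f (pderiv_at a (pderiv_at d \<Phi>)) x))"

definition frobenius_locus ::
  "(real^'n::finite) set \<Rightarrow> (real^'n \<Rightarrow> real) \<Rightarrow> 'n metric \<Rightarrow> (real^'n) set \<Rightarrow> bool" where
  "frobenius_locus D \<Phi> g N \<longleftrightarrow> N \<subseteq> D \<and> (\<forall>x\<in>N. wdvv_at \<Phi> g x)"

end

theory Submission
  imports Defs
begin

text \<open>For a Hessian metric the lowered Christoffel symbols are \<open>T\<^sub>i\<^sub>j\<^sub>k / 2\<close>, with \<open>T\<close> the totally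
  symmetric tensor of third derivatives of the potential. Differentiating
  \<open>\<Sum>\<^sub>l g\<^sub>p\<^sub>l \<Gamma>\<^sup>l\<^sub>j\<^sub>k = T\<^sub>j\<^sub>k\<^sub>p / 2\<close> expresses \<open>\<Sum>\<^sub>l g\<^sub>p\<^sub>l \<partial>\<^sub>i\<Gamma>\<^sup>l\<^sub>j\<^sub>k\<close> through fourth derivatives, which cancel
  in the antisymmetrisation over \<open>i, j\<close>. What remains of the lowered curvature is
  \<open>- 1/4\<close> times the difference of the two sides of the associativity equation.\<close>

section \<open>Symmetry of iterated partial derivatives\<close>

text \<open>The mean value theorem in direction \<open>u\<close>, applied to the difference of
  \<open>F\<close> along two parallel segments, leaves a difference of values of
  \<open>F' _ u\<close>; differentiability of \<open>\<lambda>y. F' y u\<close> at \<open>x\<close>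
  evaluates it up to \<open>o(t)\<close>.\<close>

lemma second_difference_quotient_tendsto:
  fixes F :: "'a::real_normed_vector \<Rightarrow> real"
  assumes S: "open S" "x \<in> S"
    and F: "\<And>y. y \<in> S \<Longrightarrow> (F has_derivative F' y) (at y)"
    and L: "((\<lambda>y. F' y u) has_derivative L) (at x)"
  shows "((\<lambda>t. (F (x + t *\<^sub>R u + t *\<^sub>R v) - F (x + t *\<^sub>R u) - F (x + t *\<^sub>R v) + F x) / t\<^sup>2)
    \<longlongrightarrow> L v) (at_right 0)"
proof (rule tendstoI)
  fix e :: real
  assume e: "e > 0"
  interpret L: bounded_linear L
    using L by (rule has_derivative_bounded_linear)
  \<comment> \<open>\<open>t * c\<close> bounds every displacement
    \<open>s *\<^sub>R u + r *\<^sub>R v\<close> with \<open>s\<close>, \<open>r\<close> in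
    \<open>[0, t]\<close>; the summand 1 keeps \<open>c\<close> positive when
    \<open>u = v = 0\<close>.\<close>
  define c where "c = norm u + norm v + 1"
  have c: "c > 0"
    unfolding c_def by (simp add: add_nonneg_pos)
  \<comment> \<open>Two linearisation errors of at most \<open>e' * (t * c)\<close> each will add up
    to \<open>t * e / 2\<close>, strictly below \<open>t * e\<close>.\<close>
  define e' where "e' = e / (4 * c)"
  have e': "e' > 0"
    using e c by (simp add: e'_def)
  obtain d0 where d0: "d0 > 0" "ball x d0 \<subseteq> S"
    using S openE by blast
  obtain d1 where d1: "d1 > 0"
    and d1': "\<And>y. norm (y - x) < d1 \<Longrightarrow> norm (F' y u - F' x u - L (y - x)) \<le> e' * norm (y - x)"
    using L e' unfolding has_derivative_at_alt by blast
  have bound: "dist ((F (x + t *\<^sub>R u + t *\<^sub>R v) - F (x + t *\<^sub>R u) - F (x + t *\<^sub>R v) + F x) / t\<^sup>2) (L v) < e"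
    if t: "0 < t" "t < min d0 d1 / c" for t
  proof -
    have tc: "t * c < d0" "t * c < d1"
      using t c by (auto simp: field_simps)
    have small: "norm (s *\<^sub>R u + r *\<^sub>R v) \<le> t * c" if "0 \<le> s" "s \<le> t" "0 \<le> r" "r \<le> t" for s r
    proof -
      have "norm (s *\<^sub>R u + r *\<^sub>R v) \<le> s * norm u + r * norm v"
        using norm_triangle_ineq[of "s *\<^sub>R u" "r *\<^sub>R v"] that by simp
      also have "\<dots> \<le> t * norm u + t * norm v"
        using that by (intro add_mono mult_right_mono) auto
      also have "\<dots> \<le> t * c"
        using t by (simp add: c_def algebra_simps)
      finally show ?thesis .
    qed
    have inS: "x + s *\<^sub>R u + r *\<^sub>R v \<in> S" if "0 \<le> s" "s \<le> t" "0 \<le> r" "r \<le> t" for s r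
    proof -
      have "norm (s *\<^sub>R u + r *\<^sub>R v) < d0"
        using small[OF that] tc by linarith
      then have "x + s *\<^sub>R u + r *\<^sub>R v \<in> ball x d0"
        by (simp add: mem_ball dist_commute[of x]) (simp add: dist_norm add.assoc)
      then show ?thesis using d0 by blast
    qed
    have lin: "\<bar>F' (x + s *\<^sub>R u + r *\<^sub>R v) u - F' x u - L (s *\<^sub>R u + r *\<^sub>R v)\<bar> \<le> e' * (t * c)"
      if "0 \<le> s" "s \<le> t" "0 \<le> r" "r \<le> t" for s r
    proof -
      have "norm (s *\<^sub>R u + r *\<^sub>R v) < d1"
        using small[OF that] tc by linarith
      then have "\<bar>F' (x + s *\<^sub>R u + r *\<^sub>R v) u - F' x u - L (s *\<^sub>R u + r *\<^sub>R v)\<bar>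
          \<le> e' * norm (s *\<^sub>R u + r *\<^sub>R v)"
        using d1'[of "x + (s *\<^sub>R u + r *\<^sub>R v)"] by (simp add: add.assoc)
      also have "\<dots> \<le> e' * (t * c)"
        using small[OF that] e' by (simp add: mult_left_mono)
      finally show ?thesis .
    qed
    have path: "((\<lambda>s. F (x + s *\<^sub>R u + r *\<^sub>R v)) has_real_derivative F' (x + s *\<^sub>R u + r *\<^sub>R v) u) (at s)"
      if "0 \<le> s" "s \<le> t" "0 \<le> r" "r \<le> t" for s r
    proof -
      note D = F[OF inS[OF that]]
      have "((\<lambda>s. x + s *\<^sub>R u + r *\<^sub>R v) has_derivative (\<lambda>h. h *\<^sub>R u)) (at s)"
        by (auto intro!: derivative_eq_intros)
      from has_derivative_compose[OF this D]
      have "((\<lambda>s. F (x + s *\<^sub>R u + r *\<^sub>R v)) has_derivative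
          (\<lambda>h. F' (x + s *\<^sub>R u + r *\<^sub>R v) (h *\<^sub>R u))) (at s)" .
      moreover have "F' (x + s *\<^sub>R u + r *\<^sub>R v) (h *\<^sub>R u) = F' (x + s *\<^sub>R u + r *\<^sub>R v) u * h" for h
        using linear_scale[OF has_derivative_linear[OF D]] by simp
      ultimately show ?thesis
        by (simp add: has_field_derivative_def)
    qed
    \<comment> \<open>The increment of this function over \<open>[0, t]\<close> is the whole second
      difference, so one application of the mean value theorem suffices.\<close>
    have "((\<lambda>s. F (x + s *\<^sub>R u + t *\<^sub>R v) - F (x + s *\<^sub>R u)) has_real_derivative
        F' (x + s *\<^sub>R u + t *\<^sub>R v) u - F' (x + s *\<^sub>R u) u) (at s)" if "0 \<le> s" "s \<le> t" for s
      using DERIV_diff[OF path[of s t] path[of s 0]] that t by simp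
    from MVT2[OF t(1) this] obtain z where z: "0 < z" "z < t"
      and mvt: "F (x + t *\<^sub>R u + t *\<^sub>R v) - F (x + t *\<^sub>R u) - (F (x + 0 *\<^sub>R u + t *\<^sub>R v) - F (x + 0 *\<^sub>R u))
        = (t - 0) * (F' (x + z *\<^sub>R u + t *\<^sub>R v) u - F' (x + z *\<^sub>R u) u)"
      by blast
    define q where "q = F' (x + z *\<^sub>R u + t *\<^sub>R v) u - F' (x + z *\<^sub>R u) u"
    \<comment> \<open>In the difference of the two linearisations at \<open>x\<close> the terms
      \<open>F' x u\<close> and \<open>L (z *\<^sub>R u)\<close> cancel, leaving
      \<open>t * L v\<close>.\<close>
    have "\<bar>q - t * L v\<bar> \<le> 2 * (e' * (t * c))"
      using lin[of z t] lin[of z 0] z t by (simp add: q_def L.add L.scaleR)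
    also have "2 * (e' * (t * c)) = t * (e / 2)"
      using c by (simp add: e'_def)
    finally have "\<bar>q - t * L v\<bar> < t * e"
      using mult_pos_pos[OF t(1) e] by simp
    moreover have "q / t - L v = (q - t * L v) / t"
      using t by (simp add: field_simps)
    ultimately have "\<bar>q / t - L v\<bar> < e"
      using t by (simp add: field_simps abs_divide)
    moreover have "(F (x + t *\<^sub>R u + t *\<^sub>R v) - F (x + t *\<^sub>R u) - F (x + t *\<^sub>R v) + F x) / t\<^sup>2 = q / t"
    proof -
      have "F (x + t *\<^sub>R u + t *\<^sub>R v) - F (x + t *\<^sub>R u) - F (x + t *\<^sub>R v) + F x = t * q"
        using mvt by (simp add: q_def)
      then show ?thesis
        using t by (simp add: power2_eq_square)
    qed
    ultimately show ?thesis
      by (simp add: dist_real_def)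
  qed
  have "min d0 d1 / c > 0"
    using d0 d1 c by simp
  then have "\<forall>\<^sub>F t in at_right 0. 0 < t \<and> t < min d0 d1 / c"
    by (intro eventually_at_rightI[of 0 "min d0 d1 / c"]) auto
  then show "\<forall>\<^sub>F t in at_right 0.
      dist ((F (x + t *\<^sub>R u + t *\<^sub>R v) - F (x + t *\<^sub>R u) - F (x + t *\<^sub>R v) + F x) / t\<^sup>2) (L v) < e"
    by (rule eventually_mono) (use bound in auto)
qed

text \<open>The second difference is symmetric in \<open>u\<close> and \<open>v\<close>, so
  \<open>L v\<close> and \<open>M u\<close> are limits of the same quotient.\<close>

lemma second_derivative_symmetric:
  fixes F :: "'a::real_normed_vector \<Rightarrow> real"
  assumes "open S" "x \<in> S"
    and "\<And>y. y \<in> S \<Longrightarrow> (F has_derivative F' y) (at y)"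
    and "((\<lambda>y. F' y u) has_derivative L) (at x)" "((\<lambda>y. F' y v) has_derivative M) (at x)"
  shows "L v = M u"
proof (rule tendsto_unique[OF trivial_limit_at_right_real])
  show "((\<lambda>t. (F (x + t *\<^sub>R u + t *\<^sub>R v) - F (x + t *\<^sub>R u) - F (x + t *\<^sub>R v) + F x) / t\<^sup>2)
      \<longlongrightarrow> L v) (at_right 0)"
    using assms by (intro second_difference_quotient_tendsto) auto
  have "((\<lambda>t. (F (x + t *\<^sub>R v + t *\<^sub>R u) - F (x + t *\<^sub>R v) - F (x + t *\<^sub>R u) + F x) / t\<^sup>2)
      \<longlongrightarrow> M u) (at_right 0)"
    using assms by (intro second_difference_quotient_tendsto) auto
  then show "((\<lambda>t. (F (x + t *\<^sub>R u + t *\<^sub>R v) - F (x + t *\<^sub>R u) - F (x + t *\<^sub>R v) + F x) / t\<^sup>2)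
      \<longlongrightarrow> M u) (at_right 0)"
    by (simp add: algebra_simps)
qed

section \<open>Calculus rules for \<open>pderiv_at\<close>\<close>

lemma pderiv_at_cong:
  assumes "open U" "x \<in> U" "\<And>y. y \<in> U \<Longrightarrow> F y = G y"
  shows "pderiv_at i F x = pderiv_at i G x"
proof -
  \<comment> \<open>\<open>frechet_derivative\<close> chooses some derivative; since
    \<open>F\<close> and \<open>G\<close> have the same derivatives at \<open>x\<close>, the choices
    agree, even at points of non-differentiability.\<close>
  have "(F has_derivative D) (at x) \<longleftrightarrow> (G has_derivative D) (at x)" for D
    using has_derivative_transform_within_open[of F D x UNIV U G]
      has_derivative_transform_within_open[of G D x UNIV U F] assms by auto
  then show ?thesis
    by (simp add: pderiv_at_def frechet_derivative_def)
qed

lemma pderiv_at_has_derivative: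
  "(F has_derivative F') (at x) \<Longrightarrow> pderiv_at i F x = F' (axis i 1)"
  by (simp add: pderiv_at_def flip: frechet_derivative_at)

lemma pderiv_at_sum_mult:
  assumes "finite I"
    and "\<And>l. l \<in> I \<Longrightarrow> F l differentiable at x" "\<And>l. l \<in> I \<Longrightarrow> G l differentiable at x"
  shows "pderiv_at i (\<lambda>y. \<Sum>l\<in>I. F l y * G l y) x =
    (\<Sum>l\<in>I. pderiv_at i (F l) x * G l x + F l x * pderiv_at i (G l) x)"
proof -
  have "((\<lambda>y. \<Sum>l\<in>I. F l y * G l y) has_derivative
      (\<lambda>h. \<Sum>l\<in>I. F l x * frechet_derivative (G l) (at x) h + frechet_derivative (F l) (at x) h * G l x)) (at x)"
    using assms by (intro has_derivative_sum has_derivative_mult) (auto simp: frechet_derivative_works)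
  from pderiv_at_has_derivative[OF this] show ?thesis
    by (simp add: pderiv_at_def add.commute)
qed

lemma pderiv_at_divide_const:
  assumes "F differentiable at x"
  shows "pderiv_at i (\<lambda>y. F y / c) x = pderiv_at i F x / c"
proof -
  have "((\<lambda>y. F y / c) has_derivative (\<lambda>h. frechet_derivative F (at x) h / c)) (at x)"
    using bounded_linear.has_derivative[OF bounded_linear_divide] assms
    by (simp add: frechet_derivative_works)
  from pderiv_at_has_derivative[OF this] show ?thesis
    by (simp add: pderiv_at_def)
qed

lemma smooth_on_pderiv_at: "smooth_on F U \<Longrightarrow> smooth_on (pderiv_at i F) U"
  unfolding smooth_on_def by (metis Ck_on.simps(2))

lemma smooth_on_differentiable:
  assumes "smooth_on F U" "open U" "x \<in> U"
  shows "F differentiable at x"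
proof -
  have "Ck_on (Suc 0) F U"
    using assms(1) unfolding smooth_on_def by blast
  then show ?thesis
    using assms(2,3) by (simp add: differentiable_on_eq_differentiable_at)
qed

lemma pderiv_at_commute:
  assumes "smooth_on F U" "open U" "x \<in> U"
  shows "pderiv_at i (pderiv_at j F) x = pderiv_at j (pderiv_at i F) x"
proof -
  have "((\<lambda>y. frechet_derivative F (at y) (axis k 1)) has_derivative
      frechet_derivative (pderiv_at k F) (at x)) (at x)" for k
    using smooth_on_differentiable[OF smooth_on_pderiv_at[OF assms(1), of k] assms(2,3)]
    by (simp add: frechet_derivative_works pderiv_at_def[abs_def])
  moreover have "(F has_derivative frechet_derivative F (at y)) (at y)" if "y \<in> U" for y
    using smooth_on_differentiable[OF assms(1,2) that] by (simp add: frechet_derivative_works)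
  ultimately have "frechet_derivative (pderiv_at j F) (at x) (axis i 1)
      = frechet_derivative (pderiv_at i F) (at x) (axis j 1)"
    \<comment> \<open>The directions are \<open>u = axis j 1\<close> and
      \<open>v = axis i 1\<close>.\<close>
    by (intro second_derivative_symmetric[OF assms(2,3), where F' = "\<lambda>y. frechet_derivative F (at y)"])
  then show ?thesis
    by (simp add: pderiv_at_def)
qed

section \<open>The inverse of a differentiable matrix field\<close>

lemma differentiable_transform_within_open:
  assumes "F differentiable at x" "open U" "x \<in> U" "\<And>y. y \<in> U \<Longrightarrow> F y = G y"
  shows "G differentiable at x"
proof -
  obtain F' where "(F has_derivative F') (at x)"
    using assms(1) unfolding differentiable_def by blast
  then have "(G has_derivative F') (at x)"
    using assms(2-4) by (rule has_derivative_transform_within_open)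
  then show ?thesis
    unfolding differentiable_def by blast
qed

lemma differentiable_prod:
  fixes f :: "'i \<Rightarrow> 'a::real_normed_vector \<Rightarrow> 'b::real_normed_field"
  assumes "\<And>i. i \<in> I \<Longrightarrow> f i differentiable at x within S"
  shows "(\<lambda>y. \<Prod>i\<in>I. f i y) differentiable at x within S"
  using assms by (induction I rule: infinite_finite_induct) auto

lemma differentiable_det:
  fixes M :: "'a::real_normed_vector \<Rightarrow> real^'n^'n"
  assumes "\<And>i j. (\<lambda>y. M y $ i $ j) differentiable at x"
  shows "(\<lambda>y. det (M y)) differentiable at x"
  unfolding det_def
  by (intro differentiable_sum ballI differentiable_mult differentiable_prod assms
      differentiable_const finite_permutations finite)

lemma matrix_mult_matrix_inv:
  fixes A :: "real^'n^'n"
  assumes "det A \<noteq> 0"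
  shows "A ** matrix_inv A = mat 1"
proof -
  have "\<exists>B. A ** B = mat 1 \<and> B ** A = mat 1"
    using assms by (simp add: invertible_det_nz[symmetric] invertible_def)
  then show ?thesis
    unfolding matrix_inv_def by (rule someI2_ex) blast
qed

text \<open>This is \<open>A (A^-1 v) = v\<close> in components; it serves to lower the upper index
  of the Christoffel symbols.\<close>

lemma sum_matrix_inv:
  fixes A :: "real^'n^'n"
  assumes "det A \<noteq> 0"
  shows "(\<Sum>k\<in>UNIV. A $ i $ k * (\<Sum>l\<in>UNIV. matrix_inv A $ k $ l * v l)) = v i"
proof -
  have "(\<Sum>k\<in>UNIV. A $ i $ k * (\<Sum>l\<in>UNIV. matrix_inv A $ k $ l * v l))
      = (A *v (matrix_inv A *v (\<chi> l. v l))) $ i"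
    by (simp add: matrix_vector_mult_def)
  also have "\<dots> = v i"
    using matrix_mult_matrix_inv[OF assms] by (simp add: matrix_vector_mul_assoc)
  finally show ?thesis .
qed

text \<open>Column \<open>l\<close> of the inverse solves \<open>A *v y = axis l 1\<close>, so
  Cramer's rule writes its entries as quotients of determinants, whose differentiability is clear
  from the Leibniz formula.\<close>

lemma matrix_inv_cramer:
  fixes A :: "real^'n^'n"
  assumes "det A \<noteq> 0"
  shows "matrix_inv A $ k $ l = det (\<chi> i j. if j = k then axis l 1 $ i else A $ i $ j) / det A"
proof -
  have "A *v (matrix_inv A *v axis l 1) = axis l 1"
    using matrix_mult_matrix_inv[OF assms] by (simp add: matrix_vector_mul_assoc)
  then have "matrix_inv A *v axis l 1 =
      (\<chi> k. det (\<chi> i j. if j = k then axis l 1 $ i else A $ i $ j) / det A)"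
    using cramer[OF assms] by blast
  then show ?thesis
    by (simp add: matrix_vector_mul_component matrix_vector_mult_basis column_def vec_eq_iff)
qed

lemma differentiable_matrix_inv:
  fixes M :: "'a::real_normed_vector \<Rightarrow> real^'n^'n"
  assumes U: "open U" "x \<in> U" and det: "\<And>y. y \<in> U \<Longrightarrow> det (M y) \<noteq> 0"
    and M: "\<And>i j. (\<lambda>y. M y $ i $ j) differentiable at x"
  shows "(\<lambda>y. matrix_inv (M y) $ k $ l) differentiable at x"
proof -
  let ?N = "\<lambda>y. \<chi> i j. if j = k then axis l 1 $ i else M y $ i $ j"
  have "(\<lambda>y. ?N y $ i $ j) differentiable at x" for i j
    by (cases "j = k") (simp_all add: M)
  then have "(\<lambda>y. det (?N y) / det (M y)) differentiable at x"
    using U det by (intro differentiable_divide differentiable_det M)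
  moreover have "det (?N y) / det (M y) = matrix_inv (M y) $ k $ l" if "y \<in> U" for y
    using matrix_inv_cramer[OF det[OF that]] by simp
  ultimately show ?thesis
    by (rule differentiable_transform_within_open[OF _ U])
qed

section \<open>The curvature of a Hessian metric\<close>

text \<open>The pointwise algebra of the argument: \<open>H\<close> stands for the metric,
  \<open>\<Gamma>\<close> for the Christoffel symbols, \<open>d\<Gamma> i\<close> for their
  derivative in direction \<open>i\<close>, \<open>T\<close> and \<open>Q\<close> for the third and
  fourth derivatives of the potential. \<open>deriv\<close> is \<open>lower\<close> differentiated,
  with \<open>T i p l\<close> as the derivative of \<open>H p l\<close>.\<close>

lemma wdvv_of_flat_algebra:
  fixes H :: "'n::finite \<Rightarrow> 'n \<Rightarrow> real"
    and \<Gamma> T :: "'n \<Rightarrow> 'n \<Rightarrow> 'n \<Rightarrow> real"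
    and d\<Gamma> Q :: "'n \<Rightarrow> 'n \<Rightarrow> 'n \<Rightarrow> 'n \<Rightarrow> real"
  assumes lower: "\<And>p j k. (\<Sum>l\<in>UNIV. H p l * \<Gamma> l j k) = T j k p / 2"
    and deriv: "\<And>i p j k. (\<Sum>l\<in>UNIV. T i p l * \<Gamma> l j k + H p l * d\<Gamma> i l j k) = Q i j k p / 2"
    and flat: "\<And>l k i j. d\<Gamma> i l j k - d\<Gamma> j l i k +
      (\<Sum>m\<in>UNIV. \<Gamma> l i m * \<Gamma> m j k - \<Gamma> l j m * \<Gamma> m i k) = 0"
    and T: "\<And>i j k. T i j k = T i k j"
    and Q: "\<And>i j k p. Q i j k p = Q j i k p"
  shows "(\<Sum>l\<in>UNIV. T i p l * \<Gamma> l j k) = (\<Sum>l\<in>UNIV. T j p l * \<Gamma> l i k)"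
proof -
  define S where "S i j = (\<Sum>l\<in>UNIV. T i p l * \<Gamma> l j k)" for i j
  \<comment> \<open>Exchanging the sums lets \<open>H\<close> lower the index of the first factor,
    which becomes \<open>T i m p / 2\<close>.\<close>
  have quad: "(\<Sum>l\<in>UNIV. H p l * (\<Sum>m\<in>UNIV. \<Gamma> l i m * \<Gamma> m j k)) = S i j / 2" for i j
  proof -
    have "(\<Sum>l\<in>UNIV. H p l * (\<Sum>m\<in>UNIV. \<Gamma> l i m * \<Gamma> m j k))
        = (\<Sum>m\<in>UNIV. (\<Sum>l\<in>UNIV. H p l * \<Gamma> l i m) * \<Gamma> m j k)"
      by (subst sum.swap[where A = UNIV and B = UNIV, of "\<lambda>m l. H p l * \<Gamma> l i m * \<Gamma> m j k", folded sum_distrib_right])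
        (simp add: sum_distrib_left mult.assoc)
    also have "\<dots> = S i j / 2"
      by (simp add: lower S_def sum_divide_distrib T[of i _ p])
    finally show ?thesis .
  qed
  have lin: "(\<Sum>l\<in>UNIV. H p l * d\<Gamma> i l j k) = Q i j k p / 2 - S i j" for i j
    using deriv[of i p j k] by (simp add: S_def sum.distrib)
  have "0 = (\<Sum>l\<in>UNIV. H p l * (d\<Gamma> i l j k - d\<Gamma> j l i k +
      (\<Sum>m\<in>UNIV. \<Gamma> l i m * \<Gamma> m j k - \<Gamma> l j m * \<Gamma> m i k)))"
    by (simp add: flat)
  \<comment> \<open>The \<open>Q\<close> terms cancel by symmetry and the rest is
    \<open>- (S i j - S j i) / 2\<close>.\<close>
  also have "\<dots> = (Q i j k p / 2 - S i j) - (Q j i k p / 2 - S j i) + S i j / 2 - S j i / 2"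
    unfolding lin[symmetric] quad[symmetric]
    by (simp add: sum.distrib sum_subtractf distrib_left right_diff_distrib)
  finally have "S i j = S j i"
    using Q[of i j k p] by simp
  then show ?thesis
    by (simp add: S_def)
qed

text \<open>Curvature is assumed to vanish only at \<open>x\<close>, but the identities for the
  Christoffel symbols are proved on all of \<open>D\<close> so that they can be differentiated at
  \<open>x\<close>.\<close>

lemma wdvv_at_if_flat:
  fixes \<Phi> :: "real^'n::finite \<Rightarrow> real"
  assumes D: "open D" "x \<in> D" and smooth: "smooth_on \<Phi> D"
    and det: "\<And>y. y \<in> D \<Longrightarrow> det (hessian \<Phi> y) \<noteq> 0"
    and g: "\<And>y. y \<in> D \<Longrightarrow> g y = hessian \<Phi> y"
    and flat: "\<And>l k i j. riemann_curvature g x l k i j = 0"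
  shows "wdvv_at \<Phi> g x"
proof -
  define T where "T y i j k = pderiv_at i (pderiv_at j (pderiv_at k \<Phi>)) y" for y i j k
  define H where "H p l y = hessian \<Phi> y $ p $ l" for p l y
  \<comment> \<open>The point comes last, so that \<open>\<Gamma> l j k\<close> is a function to
    which \<open>pderiv_at\<close> applies.\<close>
  define \<Gamma> where "\<Gamma> l j k y = levi_civita g y l j k" for l j k y
  define d\<Gamma> where "d\<Gamma> i l j k = pderiv_at i (\<Gamma> l j k) x" for i l j k
  define Q where "Q i j k p = pderiv_at i (\<lambda>y. T y j k p) x" for i j k p
  note sm = smooth smooth_on_pderiv_at
  have T12: "T y i j k = T y j i k" if "y \<in> D" for y i j k
    unfolding T_def using that D by (intro pderiv_at_commute) (auto intro: sm)
  \<comment> \<open>The inner derivatives commute throughout \<open>D\<close>, hence they may be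
    exchanged under the outer one.\<close>
  have T23: "T y i j k = T y i k j" if "y \<in> D" for y i j k
    unfolding T_def using that D
    by (intro pderiv_at_cong[of D] pderiv_at_commute[of _ D]) (auto intro: sm)
  have Q: "Q i j k p = Q j i k p" for i j k p
    unfolding Q_def T_def using D by (intro pderiv_at_commute) (auto intro: sm)
  have diffT: "(\<lambda>y. T y i j k) differentiable at x" for i j k
    unfolding T_def using D by (intro smooth_on_differentiable) (auto intro: sm)
  have H: "H p l = pderiv_at p (pderiv_at l \<Phi>)" for p l
    by (auto simp: H_def hessian_def)
  have diffH: "H p l differentiable at x" for p l
    unfolding H using D by (intro smooth_on_differentiable) (auto intro: sm)
  have metric: "pderiv_at i (\<lambda>y. g y $ j $ l) y = T y i j l" if "y \<in> D" for y i j l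
    unfolding T_def using that D by (intro pderiv_at_cong[of D]) (auto simp: g hessian_def)
  have christoffel: "\<Gamma> l j k y = (\<Sum>m\<in>UNIV. matrix_inv (hessian \<Phi> y) $ l $ m * T y j k m) / 2"
    if "y \<in> D" for l j k y
  proof -
    \<comment> \<open>Total symmetry of \<open>T\<close> collapses the three terms of the
      Levi-Civita formula to one.\<close>
    have "T y j k m + T y k j m - T y m j k = T y j k m" for m
      using T12[OF that, of k j m] T12[OF that, of m j k] T23[OF that, of j m k] by simp
    then show ?thesis
      by (simp add: \<Gamma>_def levi_civita_def metric[OF that] g[OF that])
  qed
  have lower: "(\<Sum>l\<in>UNIV. H p l y * \<Gamma> l j k y) = T y j k p / 2" if "y \<in> D" for p j k y
    using sum_matrix_inv[OF det[OF that], of p "T y j k"]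
    by (simp add: christoffel[OF that] H_def flip: sum_divide_distrib)
  have "(\<lambda>y. matrix_inv (hessian \<Phi> y) $ l $ m) differentiable at x" for l m
    using D det diffH by (intro differentiable_matrix_inv[of D]) (auto simp: H_def[abs_def])
  then have "(\<lambda>y. (\<Sum>m\<in>UNIV. matrix_inv (hessian \<Phi> y) $ l $ m * T y j k m) / 2) differentiable at x" for l j k
    using diffT by (intro differentiable_divide differentiable_sum ballI differentiable_mult) auto
  \<comment> \<open>Differentiability passes from the explicit formula to \<open>\<Gamma>\<close>
    because the two agree on the open set \<open>D\<close>.\<close>
  then have diff\<Gamma>: "\<Gamma> l j k differentiable at x" for l j k
    by (rule differentiable_transform_within_open[OF _ D]) (simp add: christoffel)
  have deriv: "(\<Sum>l\<in>UNIV. T x i p l * \<Gamma> l j k x + H p l x * d\<Gamma> i l j k) = Q i j k p / 2" for i p j k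
  proof -
    have "(\<Sum>l\<in>UNIV. T x i p l * \<Gamma> l j k x + H p l x * d\<Gamma> i l j k)
        = pderiv_at i (\<lambda>y. \<Sum>l\<in>UNIV. H p l y * \<Gamma> l j k y) x"
      using pderiv_at_sum_mult[of UNIV "H p" x "\<lambda>l. \<Gamma> l j k" i] diffH diff\<Gamma>
      by (simp add: T_def H d\<Gamma>_def)
    \<comment> \<open>\<open>lower\<close> holds near \<open>x\<close>, so both sides have the same
      partial derivative there.\<close>
    also have "\<dots> = pderiv_at i (\<lambda>y. T y j k p / 2) x"
      using D lower by (rule pderiv_at_cong)
    finally show ?thesis
      by (simp add: pderiv_at_divide_const diffT Q_def)
  qed
  have "d\<Gamma> i l j k - d\<Gamma> j l i k + (\<Sum>m\<in>UNIV. \<Gamma> l i m x * \<Gamma> m j k x - \<Gamma> l j m x * \<Gamma> m i k x) = 0" for l k i j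
    using flat[of l k i j] by (simp add: riemann_curvature_def curvature_def d\<Gamma>_def \<Gamma>_def[abs_def])
  then have key: "(\<Sum>l\<in>UNIV. T x i p l * \<Gamma> l j k x) = (\<Sum>l\<in>UNIV. T x j p l * \<Gamma> l i k x)" for i p j k
    using lower[OF D(2)] deriv Q T23[OF D(2)]
    by (intro wdvv_of_flat_algebra[where H = "\<lambda>p l. H p l x" and d\<Gamma> = d\<Gamma> and Q = Q
          and \<Gamma> = "\<lambda>l j k. \<Gamma> l j k x"]) auto
  \<comment> \<open>The factor 2 undoes the one half in the Christoffel symbols.\<close>
  have side: "(\<Sum>e\<in>UNIV. \<Sum>f\<in>UNIV. T x a b e * matrix_inv (g x) $ e $ f * T x f c d)
      = (\<Sum>l\<in>UNIV. T x a b l * \<Gamma> l c d x) * 2" for a b c d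
  proof -
    have "T x f c d = T x c d f" for f
      using T12[OF D(2), of f c d] T23[OF D(2), of c f d] by simp
    moreover have "\<Gamma> l c d x * 2 = (\<Sum>m\<in>UNIV. matrix_inv (g x) $ l $ m * T x c d m)" for l
      by (simp add: christoffel[OF D(2)] g[OF D(2)])
    ultimately show ?thesis
      by (simp add: sum_distrib_right[of _ _ 2] mult.assoc) (simp add: sum_distrib_left)
  qed
  show ?thesis
    unfolding wdvv_at_def T_def[symmetric]
  proof (intro allI)
    fix a b c d
    show "(\<Sum>e\<in>UNIV. \<Sum>f\<in>UNIV. T x a b e * matrix_inv (g x) $ e $ f * T x f c d)
      = (\<Sum>e\<in>UNIV. \<Sum>f\<in>UNIV. T x b c e * matrix_inv (g x) $ e $ f * T x f a d)"
      \<comment> \<open>\<open>key\<close> exchanges \<open>a\<close> and \<open>c\<close>, giving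
        \<open>T x c b l\<close> on the right; symmetry turns it into
        \<open>T x b c l\<close>.\<close>
      unfolding side using key[of a b c d] T12[OF D(2), of b c] by simp
  qed
qed

theorem theorem4p3p1:
  fixes D N :: "(real^'n::finite) set"
    and \<Phi> f :: "real^'n \<Rightarrow> real"
    and g :: "'n metric"
    and A :: "real^'n \<Rightarrow> 'n \<Rightarrow> 'n \<Rightarrow> 'n \<Rightarrow> real"
    and nabla0 :: "'n connection"
  assumes "monge_ampere_geometrization f D \<Phi> g A nabla0"
    and "bounded D"
    and "smooth_boundary_values D \<Phi>"
    and "N \<noteq> {}"
    and "flat_locus D g N"
  shows "frobenius_locus D \<Phi> g N \<and> (\<forall>x\<in>N. wdvv_at \<Phi> g x)"
proof -
  \<comment> \<open>Positivity of \<open>f\<close> in the Monge-Ampere equation makes the Hessian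
    determinant nonzero on \<open>D\<close>, so the metric is invertible.\<close>
  have "open D" "smooth_on \<Phi> D" "\<And>y. y \<in> D \<Longrightarrow> det (hessian \<Phi> y) \<noteq> 0"
    "\<And>y. y \<in> D \<Longrightarrow> g y = hessian \<Phi> y"
    using assms(1) by (auto simp: monge_ampere_geometrization_def strictly_convex_domain_def)
  moreover have "N \<subseteq> D" "\<And>x l k i j. x \<in> N \<Longrightarrow> riemann_curvature g x l k i j = 0"
    using assms(5) by (auto simp: flat_locus_def)
  ultimately have "wdvv_at \<Phi> g x" if "x \<in> N" for x
    using that by (auto intro!: wdvv_at_if_flat[of D])
  then show ?thesis
    using \<open>N \<subseteq> D\<close> by (simp add: frobenius_locus_def)
qed

end
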